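(* Let $n\ge 2$ and $r,s\ge 1$ be integers and $k=2rs+r+s$. If $H\in\mathcal H_{2n}(2r+1,2s+1)$ (defined below), then $\chi_{la}(H)=3$.
   Context: For a graph $G$ with $q$ edges, a bijection $f:E(G)\to\{1,\dots,q\}$ is a local antimagic labeling if $f^+(u)\neq f^+(v)$ for every edge $uv$, where $f^+(u)$ is the sum of the labels of edges incident to $u$; $\chi_{la}(G)$ is the minimum number of distinct values of $f^+$ over all local antimagic labelings of $G$. Definition of $\mathcal G_{2n}(2r+1,2s+1)$ with its labeling. Let $D=8k+4$ (so $2k+1=(2r+1)(2s+1)$). Let $\Gamma$ be the graph with vertices $u_i,v_i,x_{i,j}$ ($1\le i\le 2k+1$, $1\le j\le 2n$) and edges $u_iv_i,u_ix_{i,j},v_ix_{i,j}$. Define $f:E(\Gamma)\to[1,(2k+1)(4n+1)]$: for $1\le i\le k+1$: $f(u_iv_i)=i$, $f(u_ix_{i,2n-1})=10k+7-2i$, $f(u_ix_{i,2n})=5k+2+i$, $f(v_ix_{i,1})=3k+1+i$, $f(v_ix_{i,2})=8k+6-2i$, and for $t\in\{2,\dots,n\}$: $f(u_ix_{i,2n-2t+1})=k+2-i+tD$, $f(u_ix_{i,2n-2t+2})=-3k-2+i+tD$, $f(v_ix_{i,2t-1})=-5k-3+i+tD$, $f(v_ix_{i,2t})=-k+1-i+tD$. For $k+2\le i\le 2k+1$: $f(u_iv_i)=i$, $f(u_ix_{i,2n-1})=12k+8-2i$, $f(u_ix_{i,2n})=3k+1+i$, $f(v_ix_{i,1})=k+i$,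 $f(v_ix_{i,2})=10k+7-2i$, and for $t\in\{2,\dots,n\}$: $f(u_ix_{i,2n-2t+1})=3k+3-i+tD$, $f(u_ix_{i,2n-2t+2})=-5k-3+i+tD$, $f(v_ix_{i,2t-1})=-7k-4+i+tD$, $f(v_ix_{i,2t})=k+2-i+tD$. Let $\sigma_j(i)=f(u_ix_{i,j})+f(v_ix_{i,j})$. A graph in $\mathcal G_{2n}(2r+1,2s+1)$ is obtained from $\Gamma$ by choosing, for each $j\in[1,2n]$ independently, a partition of $\{1,\dots,2k+1\}$ into $2r+1$ blocks of size $2s+1$ with $\sum_{i\in B}\sigma_j(i)=(2s+1)[(4k+3)+n(8k+4)]$ for each block $B$, and identifying, for each $j$ and block $B$, the vertices $x_{i,j}$ ($i\in B$) into one vertex (of degree $4s+2$); edge labels are inherited from $f$. Definition of $\mathcal H_{2n}(2r+1,2s+1)$. Given such a graph with its edge labeling $f$, a delete-add operation is: choose two distinct vertices $x,x'$ of degree $4s+2$ (merged vertices) and indices $i,i'$ such that $x$ is adjacent to $u_i,v_i$, $x'$ is adjacent to $u_{i'},v_{i'}$, $f(xu_i)+f(xv_i)=f(x'u_{i'})+f(x'v_{i'})=(4k+3)+n(8k+4)$, and $x,x'$ have no common neighbor; delete the edges $xu_i,xv_i,x'u_{i'},x'v_{i'}$ and add edges $xu_{i'},xv_{i'}$ with labels $f(x'u_{i'}),f(x'v_{i'})$ respectively and edges $x'u_i,x'v_i$ with labels $f(xu_i),f(xv_i)$ respectively. $\mathcal H_{2n}(2r+1,2s+1)$ is the set of graphs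 obtained from graphs in $\mathcal G_{2n}(2r+1,2s+1)$ by applying one or more successive delete-add operations (each with respect to the current graph and labeling). Such graphs may be disconnected. *)

theory Defs
  imports Main "HOL-Library.Extended_Nat" "HOL-Library.Disjoint_Sets"
begin

type_synonym 'a graph = "'a set \<times> 'a set set"

type_synonym 'a labeled_graph = "'a graph \<times> ('a set \<Rightarrow> int)"

definition induced_sum :: "'a set set \<Rightarrow> ('a set \<Rightarrow> int) \<Rightarrow> 'a \<Rightarrow> int" where
  "induced_sum E f v = (\<Sum>e | e \<in> E \<and> v \<in> e. f e)"

definition local_antimagic :: "'a graph \<Rightarrow> ('a set \<Rightarrow> int) \<Rightarrow> bool" where
  "local_antimagic G f \<longleftrightarrow>
     bij_betw f (snd G) {1..int (card (snd G))} \<and>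
     (\<forall>u v. {u, v} \<in> snd G \<longrightarrow> induced_sum (snd G) f u \<noteq> induced_sum (snd G) f v)"

text \<open>The value is \<open>\<infinity>\<close> for graphs without local antimagic labelings.\<close>

definition chi_la :: "'a graph \<Rightarrow> enat" where
  "chi_la G = (INF f \<in> {f. local_antimagic G f}. enat (card (induced_sum (snd G) f ` fst G)))"

definition degree :: "'a set set \<Rightarrow> 'a \<Rightarrow> nat" where
  "degree E v = card {e \<in> E. v \<in> e}"

text \<open>\<open>Xv B j\<close> is the vertex obtained by identifying all \<open>x\<^bsub>i,j\<^esub>\<close> with \<open>i \<in> B\<close>;
  the unmerged vertex \<open>x\<^bsub>i,j\<^esub>\<close> is \<open>Xv {i} j\<close>.\<close>

datatype vertex = Uv nat | Vv nat | Xv "nat set" nat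

text \<open>The labels of \<open>u\<^sub>i x\<^bsub>i,j\<^esub>\<close> and \<open>v\<^sub>i x\<^bsub>i,j\<^esub>\<close>, with the parameter \<open>t\<close> of the
  defining formulas solved for in terms of \<open>j\<close>; the formulas in terms of \<open>t\<close> are the
  lemmas below.\<close>

definition label_ux :: "nat \<Rightarrow> nat \<Rightarrow> nat \<Rightarrow> nat \<Rightarrow> int" where
  "label_ux k n i j = (let D = 8 * int k + 4 in
     if i \<le> k + 1 then
       if j = 2*n - 1 then 10 * int k + 7 - 2 * int i
       else if j = 2*n then 5 * int k + 2 + int i
       else if odd j then int k + 2 - int i + int ((2*n + 1 - j) div 2) * D
       else - 3 * int k - 2 + int i + int ((2*n + 2 - j) div 2) * D
     else
       if j = 2*n - 1 then 12 * int k + 8 - 2 * int i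
       else if j = 2*n then 3 * int k + 1 + int i
       else if odd j then 3 * int k + 3 - int i + int ((2*n + 1 - j) div 2) * D
       else - 5 * int k - 3 + int i + int ((2*n + 2 - j) div 2) * D)"

definition label_vx :: "nat \<Rightarrow> nat \<Rightarrow> nat \<Rightarrow> int" where
  "label_vx k i j = (let D = 8 * int k + 4 in
     if i \<le> k + 1 then
       if j = 1 then 3 * int k + 1 + int i
       else if j = 2 then 8 * int k + 6 - 2 * int i
       else if odd j then - 5 * int k - 3 + int i + int ((j + 1) div 2) * D
       else - int k + 1 - int i + int (j div 2) * D
     else
       if j = 1 then int k + int i
       else if j = 2 then 10 * int k + 7 - 2 * int i
       else if odd j then - 7 * int k - 4 + int i + int ((j + 1) div 2) * D
       else int k + 2 - int i + int (j div 2) * D)"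

lemma labels_low:
  assumes "i \<le> k + 1" "n \<ge> 1"
  shows "label_ux k n i (2*n - 1) = 10 * int k + 7 - 2 * int i"
    "label_ux k n i (2*n) = 5 * int k + 2 + int i"
    "label_vx k i 1 = 3 * int k + 1 + int i"
    "label_vx k i 2 = 8 * int k + 6 - 2 * int i"
    "t \<in> {2..n} \<Longrightarrow> label_ux k n i (2*n - 2*t + 1) = int k + 2 - int i + int t * (8 * int k + 4)"
    "t \<in> {2..n} \<Longrightarrow> label_ux k n i (2*n - 2*t + 2) = - 3 * int k - 2 + int i + int t * (8 * int k + 4)"
    "t \<in> {2..n} \<Longrightarrow> label_vx k i (2*t - 1) = - 5 * int k - 3 + int i + int t * (8 * int k + 4)"
    "t \<in> {2..n} \<Longrightarrow> label_vx k i (2*t) = - int k + 1 - int i + int t * (8 * int k + 4)"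
proof -
  show "label_ux k n i (2*n - 1) = 10 * int k + 7 - 2 * int i"
    "label_ux k n i (2*n) = 5 * int k + 2 + int i"
    "label_vx k i 1 = 3 * int k + 1 + int i"
    "label_vx k i 2 = 8 * int k + 6 - 2 * int i"
    using assms by (auto simp: label_ux_def label_vx_def Let_def)
next
  assume t: "t \<in> {2..n}"
  then obtain m where m: "n = t + m" by (metis atLeastAtMost_iff le_Suc_ex)
  obtain q where q: "t = Suc (Suc q)"
    using t by (metis atLeastAtMost_iff le_Suc_ex add_2_eq_Suc)
  have a: "(2*n + 1 - (2*m + 1)) div 2 = t" "(2*n + 2 - (2*m + 2)) div 2 = t"
    using m by auto
  have b: "2*n - 2*t + 1 = 2*m + 1" "2*n - 2*t + 2 = 2*m + 2" "2*t - 1 = 2*q + 3"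
    using m q by auto
  have c: "2*m + 1 \<noteq> 2*n - 1" "2*m + 1 \<noteq> 2*n" "2*m + 2 \<noteq> 2*n - 1" "2*m + 2 \<noteq> 2*n"
    using m q by presburger+
  have d: "(2*q + 3 + 1) div 2 = t" "2*q+3 \<noteq> 1" "2*q+3 \<noteq> 2" "2*t \<noteq> 1" "2*t \<noteq> 2"
    using q by presburger+
  show "label_ux k n i (2*n - 2*t + 1) = int k + 2 - int i + int t * (8 * int k + 4)"
    "label_ux k n i (2*n - 2*t + 2) = - 3 * int k - 2 + int i + int t * (8 * int k + 4)"
    "label_vx k i (2*t - 1) = - 5 * int k - 3 + int i + int t * (8 * int k + 4)"
    "label_vx k i (2*t) = - int k + 1 - int i + int t * (8 * int k + 4)"
    unfolding label_ux_def label_vx_def Let_def b a d(1)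
    using assms(1) c d by auto
qed

lemma labels_high:
  assumes "i \<ge> k + 2" "n \<ge> 1"
  shows "label_ux k n i (2*n - 1) = 12 * int k + 8 - 2 * int i"
    "label_ux k n i (2*n) = 3 * int k + 1 + int i"
    "label_vx k i 1 = int k + int i"
    "label_vx k i 2 = 10 * int k + 7 - 2 * int i"
    "t \<in> {2..n} \<Longrightarrow> label_ux k n i (2*n - 2*t + 1) = 3 * int k + 3 - int i + int t * (8 * int k + 4)"
    "t \<in> {2..n} \<Longrightarrow> label_ux k n i (2*n - 2*t + 2) = - 5 * int k - 3 + int i + int t * (8 * int k + 4)"
    "t \<in> {2..n} \<Longrightarrow> label_vx k i (2*t - 1) = - 7 * int k - 4 + int i + int t * (8 * int k + 4)"
    "t \<in> {2..n} \<Longrightarrow> label_vx k i (2*t) = int k + 2 - int i + int t * (8 * int k + 4)"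
proof -
  show "label_ux k n i (2*n - 1) = 12 * int k + 8 - 2 * int i"
    "label_ux k n i (2*n) = 3 * int k + 1 + int i"
    "label_vx k i 1 = int k + int i"
    "label_vx k i 2 = 10 * int k + 7 - 2 * int i"
    using assms by (auto simp: label_ux_def label_vx_def Let_def)
next
  assume t: "t \<in> {2..n}"
  then obtain m where m: "n = t + m" by (metis atLeastAtMost_iff le_Suc_ex)
  obtain q where q: "t = Suc (Suc q)"
    using t by (metis atLeastAtMost_iff le_Suc_ex add_2_eq_Suc)
  have a: "(2*n + 1 - (2*m + 1)) div 2 = t" "(2*n + 2 - (2*m + 2)) div 2 = t"
    using m by auto
  have b: "2*n - 2*t + 1 = 2*m + 1" "2*n - 2*t + 2 = 2*m + 2" "2*t - 1 = 2*q + 3"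
    using m q by auto
  have c: "2*m + 1 \<noteq> 2*n - 1" "2*m + 1 \<noteq> 2*n" "2*m + 2 \<noteq> 2*n - 1" "2*m + 2 \<noteq> 2*n"
    using m q by presburger+
  have d: "(2*q + 3 + 1) div 2 = t" "2*q+3 \<noteq> 1" "2*q+3 \<noteq> 2" "2*t \<noteq> 1" "2*t \<noteq> 2"
    using q by presburger+
  show "label_ux k n i (2*n - 2*t + 1) = 3 * int k + 3 - int i + int t * (8 * int k + 4)"
    "label_ux k n i (2*n - 2*t + 2) = - 5 * int k - 3 + int i + int t * (8 * int k + 4)"
    "label_vx k i (2*t - 1) = - 7 * int k - 4 + int i + int t * (8 * int k + 4)"
    "label_vx k i (2*t) = int k + 2 - int i + int t * (8 * int k + 4)"
    unfolding label_ux_def label_vx_def Let_def b a d(1)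
    using assms(1) c d by auto
qed

definition Gamma_verts :: "nat \<Rightarrow> nat \<Rightarrow> vertex set" where
  "Gamma_verts k n = Uv ` {1..2*k+1} \<union> Vv ` {1..2*k+1} \<union>
     {Xv {i} j | i j. i \<in> {1..2*k+1} \<and> j \<in> {1..2*n}}"

definition Gamma_edges :: "nat \<Rightarrow> nat \<Rightarrow> vertex set set" where
  "Gamma_edges k n = {{Uv i, Vv i} | i. i \<in> {1..2*k+1}} \<union>
     {{Uv i, Xv {i} j} | i j. i \<in> {1..2*k+1} \<and> j \<in> {1..2*n}} \<union>
     {{Vv i, Xv {i} j} | i j. i \<in> {1..2*k+1} \<and> j \<in> {1..2*n}}"

definition Gamma_label :: "nat \<Rightarrow> nat \<Rightarrow> vertex set \<Rightarrow> int" where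
  "Gamma_label k n e = (THE l.
     (\<exists>i. e = {Uv i, Vv i} \<and> l = int i) \<or>
     (\<exists>i j. e = {Uv i, Xv {i} j} \<and> l = label_ux k n i j) \<or>
     (\<exists>i j. e = {Vv i, Xv {i} j} \<and> l = label_vx k i j))"

definition Gamma :: "nat \<Rightarrow> nat \<Rightarrow> vertex labeled_graph" where
  "Gamma k n = ((Gamma_verts k n, Gamma_edges k n), Gamma_label k n)"

lemma Gamma_label_simps:
  "Gamma_label k n {Uv i, Vv i} = int i"
  "Gamma_label k n {Uv i, Xv {i} j} = label_ux k n i j"
  "Gamma_label k n {Vv i, Xv {i} j} = label_vx k i j"
  by (auto simp: Gamma_label_def doubleton_eq_iff)

definition sigma :: "nat \<Rightarrow> nat \<Rightarrow> nat \<Rightarrow> nat \<Rightarrow> int" where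
  "sigma k n j i = Gamma_label k n {Uv i, Xv {i} j} + Gamma_label k n {Vv i, Xv {i} j}"

definition pair_sum :: "nat \<Rightarrow> nat \<Rightarrow> int" where
  "pair_sum k n = (4 * int k + 3) + int n * (8 * int k + 4)"

text \<open>Identification of vertices along a map \<open>h\<close>. The labels are inherited in the intended way
  if no two edges become parallel, i.e. if \<open>(`) h\<close> is injective on the edges; for the
  identifications used here see \<open>inj_on_merge\<close>.\<close>

definition identify :: "('a \<Rightarrow> 'a) \<Rightarrow> 'a labeled_graph \<Rightarrow> 'a labeled_graph" where
  "identify h = (\<lambda>((W, E), f). ((h ` W, (`) h ` E), f \<circ> the_inv_into E ((`) h)))"

text \<open>Sends \<open>x\<^bsub>i,j\<^esub>\<close> to \<open>Xv B j\<close>, where \<open>B\<close> is the block of the partition \<open>P j\<close>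
  containing \<open>i\<close>.\<close>

fun merge :: "(nat \<Rightarrow> nat set set) \<Rightarrow> vertex \<Rightarrow> vertex" where
  "merge P (Uv i) = Uv i"
| "merge P (Vv i) = Vv i"
| "merge P (Xv I j) = Xv (THE B. B \<in> P j \<and> I \<subseteq> B) j"

definition admissible :: "nat \<Rightarrow> nat \<Rightarrow> nat \<Rightarrow> nat \<Rightarrow> nat \<Rightarrow> nat set set \<Rightarrow> bool" where
  "admissible k n r s j Q \<longleftrightarrow>
     partition_on {1..2*k+1} Q \<and> card Q = 2*r + 1 \<and>
     (\<forall>B\<in>Q. card B = 2*s + 1 \<and> (\<Sum>i\<in>B. sigma k n j i) = (2 * int s + 1) * pair_sum k n)"

definition G_family :: "nat \<Rightarrow> nat \<Rightarrow> nat \<Rightarrow> nat \<Rightarrow> vertex labeled_graph set" where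
  "G_family k n r s =
     {identify (merge P) (Gamma k n) | P. \<forall>j\<in>{1..2*n}. admissible k n r s j (P j)}"

lemma inj_on_merge: "inj_on ((`) (merge P)) (Gamma_edges k n)"
  by (auto simp: inj_on_def Gamma_edges_def doubleton_eq_iff)

lemma merge_block:
  assumes "partition_on A (P j)" "B \<in> P j" "i \<in> B"
  shows "merge P (Xv {i} j) = Xv B j"
proof -
  have "(THE C. C \<in> P j \<and> {i} \<subseteq> C) = B"
    using assms by (intro the_equality) (auto simp: partition_on_def disjoint_def)
  then show ?thesis by simp
qed

inductive delete_add ::
  "nat \<Rightarrow> nat \<Rightarrow> nat \<Rightarrow> vertex labeled_graph \<Rightarrow> vertex labeled_graph \<Rightarrow> bool"
  for k n s :: nat where
  "\<lbrakk> x = Xv B j; x' = Xv B' j'; x \<in> W; x' \<in> W; x \<noteq> x';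
     degree E x = 4*s + 2; degree E x' = 4*s + 2;
     {x, Uv i} \<in> E; {x, Vv i} \<in> E; {x', Uv i'} \<in> E; {x', Vv i'} \<in> E;
     f {x, Uv i} + f {x, Vv i} = pair_sum k n;
     f {x', Uv i'} + f {x', Vv i'} = pair_sum k n;
     \<nexists>y. {x, y} \<in> E \<and> {x', y} \<in> E;
     E' = (E - {{x, Uv i}, {x, Vv i}, {x', Uv i'}, {x', Vv i'}})
            \<union> {{x, Uv i'}, {x, Vv i'}, {x', Uv i}, {x', Vv i}};
     f' = f({x, Uv i'} := f {x', Uv i'}, {x, Vv i'} := f {x', Vv i'},
            {x', Uv i} := f {x, Uv i}, {x', Vv i} := f {x, Vv i}) \<rbrakk>
   \<Longrightarrow> delete_add k n s ((W, E), f) ((W, E'), f')"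

definition H_family :: "nat \<Rightarrow> nat \<Rightarrow> nat \<Rightarrow> nat \<Rightarrow> vertex graph set" where
  "H_family k n r s = {H. \<exists>G\<in>G_family k n r s. \<exists>f. (delete_add k n s)\<^sup>+\<^sup>+ G (H, f)}"

end

theory Submission
  imports Defs "HOL-Combinatorics.Transposition"
begin

text \<open>
  Every graph in question is given by a map \<open>\<phi>\<close> sending each slot \<open>(i, j)\<close> to the vertex joined to
  \<open>u\<^sub>i\<close> and \<open>v\<^sub>i\<close> by the edges labeled like \<open>u\<^sub>i x\<^bsub>i,j\<^esub>\<close> and \<open>v\<^sub>i x\<^bsub>i,j\<^esub>\<close>. A delete-add operation
  composes \<open>\<phi>\<close> with a transposition of two slots of equal label sum, so the induced sums
  at all vertices survive; they are constant on the \<open>u\<^sub>i\<close>, on the \<open>v\<^sub>i\<close> and on the merged vertices.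
  With \<open>p = 2n + 1\<close>, \<open>q = 2s + 1\<close> and \<open>m = 2k + 1\<close>, a multiple of \<open>q\<close>, twice these constants are
  \<open>m p (2p - 1) + p\<close>, \<open>m (2p\<^sup>2 - 3p + 2) + p\<close> and \<open>q (4pm + 2)\<close>. If the third one equals
  one of the others then \<open>q\<close> divides \<open>p\<close>, so \<open>p = q\<close> or \<open>p \<ge> 3q\<close>, and both are excluded by size.
  Conversely each edge \<open>u\<^sub>i v\<^sub>i\<close> lies on a triangle, which forces three values.
\<close>

text \<open>Slot \<open>(i, j)\<close> stands for the vertex \<open>x\<^bsub>i,j\<^esub>\<close> before any identification.\<close>

definition slots :: "nat \<Rightarrow> nat \<Rightarrow> (nat \<times> nat) set" where
  "slots k n = {1..2*k+1} \<times> {1..2*n}"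

lemma mem_slots_iff: "p \<in> slots k n \<longleftrightarrow> fst p \<in> {1..2*k+1} \<and> snd p \<in> {1..2*n}"
  by (auto simp: slots_def mem_Times_iff)

lemma setcompr_slots:
  "{h i j | i j. i \<in> {1..2*k+1} \<and> j \<in> {1..2*n}} = (\<lambda>p. h (fst p) (snd p)) ` slots k n"
  by (force simp: slots_def)

lemma finite_slots [simp]: "finite (slots k n)"
  by (simp add: slots_def)

lemma card_slots: "card (slots k n) = (2*k+1) * (2*n)"
  by (simp add: slots_def card_cartesian_product)

section \<open>The labels fill the interval from 1 to \<open>(2*k+1) * (4*n+1)\<close>\<close>

text \<open>Modulo \<open>2*k+1\<close> both branches read \<open>k + i\<close>, a rotation of the
  residues, and the witness undoes it. The next two lemmas treat the reflection
  \<open>k + 2 - i\<close> and the map \<open>2 - 2*i\<close>, a permutation since the modulus is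
  odd. In \<open>labels_surj\<close> they locate a label within its block.\<close>

lemma shift_surj:
  assumes "1 \<le> g" "g \<le> 2 * int k + 1"
  shows "\<exists>i\<in>{1..2*k+1}. (i \<le> k + 1 \<and> g = int k + int i) \<or> (i \<ge> k + 2 \<and> g = int i - int k - 1)"
proof (cases "g \<le> int k")
  case True
  then show ?thesis using assms by (intro bexI[of _ "nat (g + int k + 1)"]) auto
next
  case False
  then show ?thesis using assms by (intro bexI[of _ "nat (g - int k)"]) auto
qed

lemma shift_neg_surj:
  assumes "1 \<le> g" "g \<le> 2 * int k + 1"
  shows "\<exists>i\<in>{1..2*k+1}. (i \<le> k + 1 \<and> g = int k + 2 - int i) \<or> (i \<ge> k + 2 \<and> g = 3 * int k + 3 - int i)"
proof (cases "g \<le> int k + 1")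
  case True
  then show ?thesis using assms by (intro bexI[of _ "nat (int k + 2 - g)"]) auto
next
  case False
  then show ?thesis using assms by (intro bexI[of _ "nat (3 * int k + 3 - g)"]) auto
qed

text \<open>The first branch runs through the odd values of \<open>g\<close> and the second through
  the even ones, hence the split on parity.\<close>

lemma double_neg_surj:
  assumes "1 \<le> g" "g \<le> 2 * int k + 1"
  shows "\<exists>i\<in>{1..2*k+1}. (i \<le> k + 1 \<and> g = 2 * int k + 3 - 2 * int i) \<or>
                         (i \<ge> k + 2 \<and> g = 4 * int k + 4 - 2 * int i)"
proof (cases "odd g")
  case True
  then obtain h where "g = 2 * h + 1" by (elim oddE)
  then show ?thesis using assms by (intro bexI[of _ "nat (int k + 1 - h)"]) auto
next
  case False
  then obtain h where "g = 2 * h" by auto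
  then show ?thesis using assms by (intro bexI[of _ "nat (2 * int k + 2 - h)"]) auto
qed

text \<open>Cut the interval into \<open>4*n+1\<close> blocks of \<open>2*k+1\<close> consecutive
  integers. Block 0 consists of the labels of the edges \<open>u_i v_i\<close>; every other block is
  the set of labels on one side of one column \<open>j\<close>, arranged by one of the three
  permutations above.\<close>

lemma labels_surj:
  assumes l: "l \<in> {1..(2 * int k + 1) * (4 * int n + 1)}"
  shows "l \<in> int ` {1..2*k+1} \<union> (\<lambda>p. label_ux k n (fst p) (snd p)) ` slots k n
            \<union> (\<lambda>p. label_vx k (fst p) (snd p)) ` slots k n" (is "_ \<in> ?R")
proof -
  define m where "m = 2 * int k + 1"
  define b where "b = (l - 1) div m"
  define g where "g = (l - 1) mod m + 1"
  have m: "m > 0" by (simp add: m_def)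
  have l_eq: "l = b * m + g" by (simp add: b_def g_def)
  have g: "1 \<le> g" "g \<le> 2 * int k + 1"
    using pos_mod_sign[OF m, of "l - 1"] pos_mod_bound[OF m, of "l - 1"]
    unfolding g_def m_def by linarith+
  have b0: "b \<ge> 0" using l m by (simp add: b_def pos_imp_zdiv_nonneg_iff)
  have "b * m < (4 * int n + 1) * m" using l l_eq g by (simp add: m_def algebra_simps)
  then have "b < 4 * int n + 1" using m mult_less_cancel_right_pos by blast
  then have b1: "b \<le> 4 * int n" by simp
  have ux: "label_ux k n i j \<in> ?R" if "i \<in> {1..2*k+1}" "j \<in> {1..2*n}" for i j
    using that by (intro UnI1 UnI2 image_eqI[of _ _ "(i, j)"]) (auto simp: mem_slots_iff)
  have vx: "label_vx k i j \<in> ?R" if "i \<in> {1..2*k+1}" "j \<in> {1..2*n}" for i j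
    using that by (intro UnI2 image_eqI[of _ _ "(i, j)"]) (auto simp: mem_slots_iff)
  show ?thesis
  proof (cases "b = 0")
    case True
    then have "l = int (nat g)" "nat g \<in> {1..2*k+1}" using l_eq g by auto
    then show ?thesis by blast
  next
    case False
    \<comment> \<open>Blocks \<open>4*t - 3\<close> to \<open>4*t\<close> belong to the parameter
      \<open>t\<close> of the labeling: in this order they hold the columns \<open>2*t - 1\<close>
      on the v side, \<open>2*n - 2*t + 2\<close> on the u side, \<open>2*t\<close> on the v side
      and \<open>2*n - 2*t + 1\<close> on the u side.\<close>
    define t where "t = nat ((b + 3) div 4)"
    have t: "1 \<le> t" "t \<le> n" using False b0 b1 unfolding t_def by linarith+
    have n1: "n \<ge> 1" using t by simp
    have "b = 4 * int t - 3 \<or> b = 4 * int t - 2 \<or> b = 4 * int t - 1 \<or> b = 4 * int t"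
      using b0 False unfolding t_def by linarith
    \<comment> \<open>In the first two blocks the special formulas for \<open>t = 1\<close> are the
      general ones evaluated at 1, so only the last two blocks need separate cases.\<close>
    then consider "b = 4 * int t - 3" | "b = 4 * int t - 2" | "b = 4 * int t - 1" "t = 1"
      | "b = 4 * int t" "t = 1" | "b = 4 * int t - 1" "t \<ge> 2" | "b = 4 * int t" "t \<ge> 2"
      using t by linarith
    then show ?thesis
    proof cases
      case 1
      obtain i where i: "i \<in> {1..2*k+1}"
        and d: "(i \<le> k + 1 \<and> g = int k + int i) \<or> (i \<ge> k + 2 \<and> g = int i - int k - 1)"
        using shift_surj[OF g] by blast
      have leq: "l = label_vx k i (2*t - 1)"
        using d t labels_low(3)[OF _ n1, of i k] labels_high(3)[OF _ n1, of k i]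
          labels_low(7)[OF _ n1, of i k t] labels_high(7)[OF _ n1, of k i t]
        by (cases "t = 1") (auto simp: l_eq 1 m_def algebra_simps)
      show ?thesis unfolding leq using t by (intro vx[OF i]) auto
    next
      case 2
      obtain i where i: "i \<in> {1..2*k+1}"
        and d: "(i \<le> k + 1 \<and> g = int k + int i) \<or> (i \<ge> k + 2 \<and> g = int i - int k - 1)"
        using shift_surj[OF g] by blast
      have "2*n - 2*t + 2 = 2*n" if "t = 1" using that n1 by simp
      then have leq: "l = label_ux k n i (2*n - 2*t + 2)"
        using d t labels_low(2)[OF _ n1, of i k] labels_high(2)[OF _ n1, of k i]
          labels_low(6)[OF _ n1, of i k t] labels_high(6)[OF _ n1, of k i t]
        by (cases "t = 1") (auto simp: l_eq 2 m_def algebra_simps)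
      show ?thesis unfolding leq using t by (intro ux[OF i]) auto
    next
      case 3
      obtain i where i: "i \<in> {1..2*k+1}"
        and d: "(i \<le> k + 1 \<and> g = 2 * int k + 3 - 2 * int i) \<or>
                (i \<ge> k + 2 \<and> g = 4 * int k + 4 - 2 * int i)"
        using double_neg_surj[OF g] by blast
      have leq: "l = label_vx k i 2"
        using d labels_low(4)[OF _ n1, of i k] labels_high(4)[OF _ n1, of k i]
        by (auto simp: l_eq 3 m_def algebra_simps)
      show ?thesis unfolding leq using n1 by (intro vx[OF i]) auto
    next
      case 4
      obtain i where i: "i \<in> {1..2*k+1}"
        and d: "(i \<le> k + 1 \<and> g = 2 * int k + 3 - 2 * int i) \<or>
                (i \<ge> k + 2 \<and> g = 4 * int k + 4 - 2 * int i)"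
        using double_neg_surj[OF g] by blast
      have leq: "l = label_ux k n i (2*n - 1)"
        using d labels_low(1)[OF _ n1, of i k] labels_high(1)[OF _ n1, of k i]
        by (auto simp: l_eq 4 m_def algebra_simps)
      show ?thesis unfolding leq using n1 by (intro ux[OF i]) auto
    next
      case 5
      obtain i where i: "i \<in> {1..2*k+1}"
        and d: "(i \<le> k + 1 \<and> g = int k + 2 - int i) \<or> (i \<ge> k + 2 \<and> g = 3 * int k + 3 - int i)"
        using shift_neg_surj[OF g] by blast
      have leq: "l = label_vx k i (2*t)"
        using d t 5 labels_low(8)[OF _ n1, of i k t] labels_high(8)[OF _ n1, of k i t]
        by (auto simp: l_eq 5(1) m_def algebra_simps)
      show ?thesis unfolding leq using t by (intro vx[OF i]) auto
    next
      case 6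
      obtain i where i: "i \<in> {1..2*k+1}"
        and d: "(i \<le> k + 1 \<and> g = int k + 2 - int i) \<or> (i \<ge> k + 2 \<and> g = 3 * int k + 3 - int i)"
        using shift_neg_surj[OF g] by blast
      have leq: "l = label_ux k n i (2*n - 2*t + 1)"
        using d t 6 labels_low(5)[OF _ n1, of i k t] labels_high(5)[OF _ n1, of k i t]
        by (auto simp: l_eq 6(1) m_def algebra_simps)
      show ?thesis unfolding leq using t by (intro ux[OF i]) auto
    qed
  qed
qed

section \<open>The sums at \<open>Uv i\<close> and \<open>Vv i\<close>\<close>

lemma sum_pairs: "(\<Sum>j=1..2*n. h j) = (\<Sum>t=1..n. h (2*t - 1) + h (2*t))"
  for h :: "nat \<Rightarrow> 'a::comm_monoid_add"
  by (induction n) (auto simp: add.assoc)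

text \<open>Fits the labels on the u side, where the parameter \<open>t\<close> counts pairs of
  columns from the end.\<close>

lemma sum_pairs_rev:
  "(\<Sum>j=1..2*n. h j) = (\<Sum>t=1..n. h (2*n - 2*t + 1) + h (2*n - 2*t + 2))"
  for h :: "nat \<Rightarrow> 'a::comm_monoid_add"
proof -
  have "(\<Sum>j=1..2*n. h j) = (\<Sum>t=1..n. h (2*(n + 1 - t) - 1) + h (2*(n + 1 - t)))"
    unfolding sum_pairs by (subst sum.atLeastAtMost_rev) (simp add: add.commute)
  also have "\<dots> = (\<Sum>t=1..n. h (2*n - 2*t + 1) + h (2*n - 2*t + 2))"
  proof (rule sum.cong[OF refl])
    fix t assume "t \<in> {1..n}"
    then have "2*(n + 1 - t) - 1 = 2*n - 2*t + 1" "2*(n + 1 - t) = 2*n - 2*t + 2" by auto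
    then show "h (2*(n + 1 - t) - 1) + h (2*(n + 1 - t)) = h (2*n - 2*t + 1) + h (2*n - 2*t + 2)"
      by simp
  qed
  finally show ?thesis .
qed

lemma sum_affine:
  fixes c d :: int
  assumes "n \<ge> 1"
  shows "(\<Sum>t=2..n. c + 2 * int t * d) = (int n - 1) * c + (int n * (int n + 1) - 2) * d"
  using assms by (induction n rule: nat_induct_at_least) (auto simp: algebra_simps)

text \<open>The constant \<open>15 * int k + 9\<close> collects the edge \<open>u_i v_i\<close> and
  the pair \<open>t = 1\<close>; the other terms collect the pairs with \<open>t\<close> from 2 to
  \<open>n\<close>.\<close>

definition u_sum :: "nat \<Rightarrow> nat \<Rightarrow> int" where
  "u_sum k n = 15 * int k + 9 - 2 * int k * (int n - 1) + (int n * (int n + 1) - 2) * (8 * int k + 4)"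

definition v_sum :: "nat \<Rightarrow> nat \<Rightarrow> int" where
  "v_sum k n = u_sum k n - int n * (4 * int k + 2)"

text \<open>For \<open>t \<ge> 2\<close> one label of each pair rises with \<open>i\<close> and the
  other falls, so \<open>i\<close> cancels. The pair \<open>t = 1\<close> leaves \<open>- i\<close>,
  which the label of \<open>u_i v_i\<close> absorbs. The same happens on the v side.\<close>

lemma sum_label_ux:
  assumes "n \<ge> 1"
  shows "int i + (\<Sum>j=1..2*n. label_ux k n i j) = u_sum k n"
proof -
  have "2 * n - 2 * 1 + 1 = 2 * n - 1" "2 * n - 2 * 1 + 2 = 2 * n" using assms by auto
  then have "(\<Sum>j=1..2*n. label_ux k n i j) =
      label_ux k n i (2*n - 1) + label_ux k n i (2*n) +
      (\<Sum>t=2..n. label_ux k n i (2*n - 2*t + 1) + label_ux k n i (2*n - 2*t + 2))"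
    unfolding sum_pairs_rev sum.atLeast_Suc_atMost[OF assms] Suc_1
    by (simp only:)
  also have "(\<Sum>t=2..n. label_ux k n i (2*n - 2*t + 1) + label_ux k n i (2*n - 2*t + 2))
      = (\<Sum>t=2..n. - 2 * int k + 2 * int t * (8 * int k + 4))"
  proof (rule sum.cong[OF refl])
    fix t assume "t \<in> {2..n}"
    then show "label_ux k n i (2*n - 2*t + 1) + label_ux k n i (2*n - 2*t + 2)
      = - 2 * int k + 2 * int t * (8 * int k + 4)"
      using labels_low(5,6)[OF _ assms, of i k t] labels_high(5,6)[OF _ assms, of k i t]
      by (cases "i \<le> k + 1") auto
  qed
  also note sum_affine[OF assms]
  finally show ?thesis
    using labels_low(1,2)[OF _ assms, of i k] labels_high(1,2)[OF _ assms, of k i]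
    by (cases "i \<le> k + 1") (auto simp: u_sum_def algebra_simps)
qed

lemma sum_label_vx:
  assumes "n \<ge> 1"
  shows "int i + (\<Sum>j=1..2*n. label_vx k i j) = v_sum k n"
proof -
  have "(\<Sum>j=1..2*n. label_vx k i j) =
      label_vx k i 1 + label_vx k i 2 + (\<Sum>t=2..n. label_vx k i (2*t - 1) + label_vx k i (2*t))"
    unfolding sum_pairs sum.atLeast_Suc_atMost[OF assms] Suc_1 by simp
  also have "(\<Sum>t=2..n. label_vx k i (2*t - 1) + label_vx k i (2*t))
      = (\<Sum>t=2..n. (- 6 * int k - 2) + 2 * int t * (8 * int k + 4))"
  proof (rule sum.cong[OF refl])
    fix t assume "t \<in> {2..n}"
    then show "label_vx k i (2*t - 1) + label_vx k i (2*t)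
      = (- 6 * int k - 2) + 2 * int t * (8 * int k + 4)"
      using labels_low(7,8)[OF _ assms, of i k t] labels_high(7,8)[OF _ assms, of k i t]
      by (cases "i \<le> k + 1") auto
  qed
  also note sum_affine[OF assms]
  finally show ?thesis
    using labels_low(3,4)[OF _ assms, of i k] labels_high(3,4)[OF _ assms, of k i]
    by (cases "i \<le> k + 1") (auto simp: v_sum_def u_sum_def algebra_simps)
qed

section \<open>The sum at a merged vertex differs from the other two\<close>

lemma odd_multiple_cases:
  fixes p q :: int
  assumes "q dvd p" "odd p" "p > 0" "q > 0"
  shows "p = q \<or> 3 * q \<le> p"
proof -
  obtain c where c: "p = q * c" using assms(1) by (elim dvdE)
  have "c > 0" using c assms(3,4) zero_less_mult_pos by blast
  moreover have "odd c" using c assms(2) by auto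
  ultimately have "c = 1 \<or> c \<ge> 3" by presburger
  then show ?thesis using c assms(4) mult_left_mono[of 3 c q] by auto
qed

lemma x_sum_neq:
  assumes "n \<ge> 2" and k: "k = 2 * r * s + r + s"
  defines "x \<equiv> (2 * int s + 1) * pair_sum k n"
  shows "x \<noteq> u_sum k n" "x \<noteq> v_sum k n"
proof -
  define m p q where "m = 2 * int k + 1" and "p = 2 * int n + 1" and "q = 2 * int s + 1"
  have mq: "m = (2 * int r + 1) * q" by (simp add: m_def q_def k algebra_simps)
  have p: "odd p" "p \<ge> 5" using assms(1) by (auto simp: p_def)
  have q: "odd q" "q \<ge> 1" by (auto simp: q_def)
  have m: "m \<ge> 1" by (simp add: m_def)
  have x2: "2 * x = q * (4 * p * m + 2)"
    by (simp add: x_def pair_sum_def m_def p_def q_def algebra_simps)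
  have u2: "2 * u_sum k n = m * (p * (2 * p - 1)) + p"
    by (simp add: u_sum_def m_def p_def algebra_simps)
  have v2: "2 * v_sum k n = m * (2 * p * p - 3 * p + 2) + p"
    by (simp add: v_sum_def u_sum_def m_def p_def algebra_simps)
  \<comment> \<open>As \<open>q\<close> divides \<open>m\<close>, the equation exhibits
    \<open>p\<close> as a multiple of \<open>q\<close>.\<close>
  have step: "p = q \<or> 3 * q \<le> p" if "q * (4 * p * m + 2) = m * z + p" for z
  proof -
    have "p = q * (4 * p * m + 2 - (2 * int r + 1) * z)"
      using that by (simp add: mq algebra_simps)
    then have "q dvd p" by (rule dvdI)
    then show ?thesis using odd_multiple_cases p q by force
  qed
  \<comment> \<open>With these products as atoms the remaining estimates are linear. The bound
    \<open>B \<ge> 5 * A\<close> comes from \<open>p \<ge> 5\<close>, that is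
    \<open>n \<ge> 2\<close>.\<close>
  define A B where "A = m * p" and "B = m * (p * p)"
  have A: "A \<ge> 5 * m" using p m by (simp add: A_def mult.commute)
  have B: "B \<ge> 5 * A" using mult_right_mono[of 5 p A] p m by (simp add: A_def B_def mult_ac)
  \<comment> \<open>The ends of the range for \<open>z\<close> are the coefficients of
    \<open>m\<close> in \<open>u2\<close> and \<open>v2\<close>, so one estimate serves both
    inequalities.\<close>
  have "q * (4 * p * m + 2) \<noteq> m * z + p"
    if z: "z \<le> p * (2 * p - 1)" "z \<ge> 2 * p * p - 3 * p + 2" for z
  proof
    assume eq: "q * (4 * p * m + 2) = m * z + p"
    have z1: "m * z \<le> 2 * B - A"
      using mult_left_mono[OF z(1), of m] m by (simp add: A_def B_def algebra_simps)
    have z2: "m * z \<ge> 2 * B - 3 * A + 2 * m"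
      using mult_left_mono[OF z(2), of m] m by (simp add: A_def B_def algebra_simps)
    have pB: "p * (4 * p * m + 2) = 4 * B + 2 * p" by (simp add: B_def algebra_simps)
    from step[OF eq] show False
    proof
      \<comment> \<open>Now the left side is \<open>4 * B + 2 * p\<close>, but the right side is at
        most \<open>2 * B - A + p\<close>.\<close>
      assume "p = q"
      then show False using eq pB z1 A B m p by auto
    next
      \<comment> \<open>Three times the equation gives \<open>2 * B + 6 * m + p \<le> 9 * A\<close>,
        against \<open>B \<ge> 5 * A\<close>.\<close>
      assume "3 * q \<le> p"
      then have "3 * q * (4 * p * m + 2) \<le> p * (4 * p * m + 2)"
        using p m by (intro mult_right_mono) auto
      then show False using eq pB z2 A B m p by linarith
    qed
  qed
  note neq = this
  show "x \<noteq> u_sum k n"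
    using neq[of "p * (2 * p - 1)"] x2 u2 p by (auto simp: algebra_simps)
  show "x \<noteq> v_sum k n"
    using neq[of "2 * p * p - 3 * p + 2"] x2 v2 p by (auto simp: algebra_simps)
qed

section \<open>Graphs given by an assignment of vertices to slots\<close>

text \<open>The invariant carried through the delete-add operations. Labels are tied to slots, so a
  change of \<open>\<phi>\<close> moves edges together with their labels. Of the block structure
  only the total label \<open>c\<close> at each merged vertex is retained.\<close>

locale slot_graph =
  fixes k n :: nat and c :: int and \<phi> :: "nat \<times> nat \<Rightarrow> vertex"
    and W :: "vertex set" and E :: "vertex set set" and f :: "vertex set \<Rightarrow> int"
  assumes is_X: "p \<in> slots k n \<Longrightarrow> \<exists>B j. \<phi> p = Xv B j"
    and no_parallel: "\<lbrakk>p \<in> slots k n; q \<in> slots k n; \<phi> p = \<phi> q; fst p = fst q\<rbrakk> \<Longrightarrow> p = q"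
    and verts: "W = Uv ` {1..2*k+1} \<union> Vv ` {1..2*k+1} \<union> \<phi> ` slots k n"
    and edges: "E = (\<lambda>i. {Uv i, Vv i}) ` {1..2*k+1}
        \<union> (\<lambda>p. {Uv (fst p), \<phi> p}) ` slots k n \<union> (\<lambda>p. {Vv (fst p), \<phi> p}) ` slots k n"
    and f_uv: "i \<in> {1..2*k+1} \<Longrightarrow> f {Uv i, Vv i} = int i"
    and f_ux: "p \<in> slots k n \<Longrightarrow> f {Uv (fst p), \<phi> p} = label_ux k n (fst p) (snd p)"
    and f_vx: "p \<in> slots k n \<Longrightarrow> f {Vv (fst p), \<phi> p} = label_vx k (fst p) (snd p)"
    and fibre_sum: "x \<in> \<phi> ` slots k n \<Longrightarrow>
      (\<Sum>p | p \<in> slots k n \<and> \<phi> p = x.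
         label_ux k n (fst p) (snd p) + label_vx k (fst p) (snd p)) = c"
begin

lemma phi_neq [simp]:
  assumes "p \<in> slots k n"
  shows "\<phi> p \<noteq> Uv i" "\<phi> p \<noteq> Vv i" "Uv i \<noteq> \<phi> p" "Vv i \<noteq> \<phi> p"
  using is_X[OF assms] by auto

lemma ux_edge_iff: "{Uv i, Xv B j} \<in> E \<longleftrightarrow> (\<exists>p\<in>slots k n. fst p = i \<and> \<phi> p = Xv B j)"
  by (auto simp: edges doubleton_eq_iff image_iff intro!: bexI)

lemma card_edges_le: "card E \<le> (2*k+1) * (4*n+1)"
proof -
  have "card E \<le> card ((\<lambda>i. {Uv i, Vv i}) ` {1..2*k+1})
      + card ((\<lambda>p. {Uv (fst p), \<phi> p}) ` slots k n) + card ((\<lambda>p. {Vv (fst p), \<phi> p}) ` slots k n)"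
    unfolding edges by (meson card_Un_le add_le_mono1 le_trans)
  also have "\<dots> \<le> card {1..2*k+1} + card (slots k n) + card (slots k n)"
    by (intro add_mono card_image_le) auto
  also have "\<dots> = (2*k+1) * (4*n+1)" by (simp add: card_slots algebra_simps)
  finally show ?thesis .
qed

text \<open>There are at most as many edges as labels, so surjectivity onto the labels suffices.\<close>

lemma bij_labels: "bij_betw f E {1..int (card E)}"
proof -
  define N where "N = (2*k+1) * (4*n+1)"
  have fin: "finite E" by (simp add: edges)
  have im: "f ` E = int ` {1..2*k+1} \<union> (\<lambda>p. label_ux k n (fst p) (snd p)) ` slots k n
            \<union> (\<lambda>p. label_vx k (fst p) (snd p)) ` slots k n"
    unfolding edges image_Un image_image using f_uv f_ux f_vx
    by (intro arg_cong2[of _ _ _ _ "(\<union>)"] image_cong) auto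
  have sub: "{1..int N} \<subseteq> f ` E"
    unfolding im using labels_surj[of _ k n] by (intro subsetI) (simp add: N_def algebra_simps)
  then have "N \<le> card (f ` E)" using card_mono[OF _ sub] fin by simp
  moreover have "card (f ` E) \<le> card E" using fin by (rule card_image_le)
  moreover have "card E \<le> N" using card_edges_le by (simp add: N_def)
  ultimately have c: "card (f ` E) = N" "card E = N" by auto
  then have "inj_on f E" using fin by (intro eq_card_imp_inj_on) auto
  moreover have "f ` E = {1..int N}"
    using card_subset_eq[OF _ sub] fin c by simp
  ultimately show ?thesis using c by (simp add: bij_betw_def)
qed

text \<open>By \<open>no_parallel\<close> the slots of row \<open>i\<close> give \<open>2*n\<close>
  different edges here, and their labels do not depend on \<open>\<phi>\<close>.\<close>

lemma induced_sum_U: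
  assumes "i \<in> {1..2*k+1}" "n \<ge> 1"
  shows "induced_sum E f (Uv i) = u_sum k n"
proof -
  have "{p \<in> slots k n. fst p = i} = Pair i ` {1..2*n}"
    using assms by (auto simp: mem_slots_iff)
  moreover have "{e \<in> E. Uv i \<in> e} =
      insert {Uv i, Vv i} ((\<lambda>p. {Uv (fst p), \<phi> p}) ` {p \<in> slots k n. fst p = i})"
    using assms by (auto simp: edges)
  ultimately have eq: "{e \<in> E. Uv i \<in> e} = insert {Uv i, Vv i} ((\<lambda>j. {Uv i, \<phi> (i, j)}) ` {1..2*n})"
    by (simp add: image_image)
  have "inj_on (\<lambda>j. {Uv i, \<phi> (i, j)}) {1..2*n}"
    using assms no_parallel[of "(i, _)" "(i, _)"]
    by (fastforce simp: inj_on_def doubleton_eq_iff mem_slots_iff)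
  moreover have "{Uv i, Vv i} \<notin> (\<lambda>j. {Uv i, \<phi> (i, j)}) ` {1..2*n}"
    using assms phi_neq[of "(i, _)"] by (fastforce simp: doubleton_eq_iff mem_slots_iff)
  ultimately have "induced_sum E f (Uv i) = int i + (\<Sum>j=1..2*n. f {Uv i, \<phi> (i, j)})"
    unfolding induced_sum_def eq by (simp add: f_uv[OF assms(1)] sum.reindex)
  also have "(\<Sum>j=1..2*n. f {Uv i, \<phi> (i, j)}) = (\<Sum>j=1..2*n. label_ux k n i j)"
    using assms f_ux[of "(i, _)"] by (intro sum.cong) (auto simp: mem_slots_iff)
  finally show ?thesis using sum_label_ux[OF assms(2)] by simp
qed

lemma induced_sum_V:
  assumes "i \<in> {1..2*k+1}" "n \<ge> 1"
  shows "induced_sum E f (Vv i) = v_sum k n"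
proof -
  have "{p \<in> slots k n. fst p = i} = Pair i ` {1..2*n}"
    using assms by (auto simp: mem_slots_iff)
  moreover have "{e \<in> E. Vv i \<in> e} =
      insert {Uv i, Vv i} ((\<lambda>p. {Vv (fst p), \<phi> p}) ` {p \<in> slots k n. fst p = i})"
    using assms by (auto simp: edges)
  ultimately have eq: "{e \<in> E. Vv i \<in> e} = insert {Uv i, Vv i} ((\<lambda>j. {Vv i, \<phi> (i, j)}) ` {1..2*n})"
    by (simp add: image_image)
  have "inj_on (\<lambda>j. {Vv i, \<phi> (i, j)}) {1..2*n}"
    using assms no_parallel[of "(i, _)" "(i, _)"]
    by (fastforce simp: inj_on_def doubleton_eq_iff mem_slots_iff)
  moreover have "{Uv i, Vv i} \<notin> (\<lambda>j. {Vv i, \<phi> (i, j)}) ` {1..2*n}"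
    using assms phi_neq[of "(i, _)"] by (fastforce simp: doubleton_eq_iff mem_slots_iff)
  ultimately have "induced_sum E f (Vv i) = int i + (\<Sum>j=1..2*n. f {Vv i, \<phi> (i, j)})"
    unfolding induced_sum_def eq by (simp add: f_uv[OF assms(1)] sum.reindex)
  also have "(\<Sum>j=1..2*n. f {Vv i, \<phi> (i, j)}) = (\<Sum>j=1..2*n. label_vx k i j)"
    using assms f_vx[of "(i, _)"] by (intro sum.cong) (auto simp: mem_slots_iff)
  finally show ?thesis using sum_label_vx[OF assms(2)] by simp
qed

text \<open>Slots in one fibre lie in different rows, so their edges at \<open>x\<close> are
  pairwise distinct and the sum becomes one over the fibre.\<close>

lemma induced_sum_X:
  assumes "x \<in> \<phi> ` slots k n"
  shows "induced_sum E f x = c"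
proof -
  define F where "F = {p \<in> slots k n. \<phi> p = x}"
  have fin: "finite F" by (simp add: F_def)
  have x: "x \<noteq> Uv i" "x \<noteq> Vv i" for i using assms by auto
  have eq: "{e \<in> E. x \<in> e} = (\<lambda>p. {Uv (fst p), \<phi> p}) ` F \<union> (\<lambda>p. {Vv (fst p), \<phi> p}) ` F"
    using x by (auto simp: edges F_def)
  have inj: "inj_on (\<lambda>p. {Uv (fst p), \<phi> p}) F" "inj_on (\<lambda>p. {Vv (fst p), \<phi> p}) F"
    using no_parallel x by (auto simp: inj_on_def F_def doubleton_eq_iff)
  have disj: "(\<lambda>p. {Uv (fst p), \<phi> p}) ` F \<inter> (\<lambda>p. {Vv (fst p), \<phi> p}) ` F = {}"
    using x by (auto simp: F_def doubleton_eq_iff)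
  have "induced_sum E f x = (\<Sum>p\<in>F. f {Uv (fst p), \<phi> p} + f {Vv (fst p), \<phi> p})"
    unfolding induced_sum_def eq
    using fin disj inj by (simp add: sum.union_disjoint sum.reindex sum.distrib)
  also have "\<dots> = (\<Sum>p\<in>F. label_ux k n (fst p) (snd p) + label_vx k (fst p) (snd p))"
    by (intro sum.cong) (use f_ux f_vx in \<open>auto simp: F_def\<close>)
  finally show ?thesis using fibre_sum[OF assms] by (simp add: F_def)
qed

lemma local_antimagic_label:
  assumes "n \<ge> 1" "c \<noteq> u_sum k n" "c \<noteq> v_sum k n"
  shows "local_antimagic (W, E) f"
proof -
  have uv: "u_sum k n \<noteq> v_sum k n" using assms(1) by (auto simp: v_sum_def)
  have "induced_sum E f u \<noteq> induced_sum E f v" if "{u, v} \<in> E" for u v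
  proof -
    from that consider i where "i \<in> {1..2*k+1}" "{u, v} = {Uv i, Vv i}"
      | p where "p \<in> slots k n" "{u, v} = {Uv (fst p), \<phi> p}"
      | p where "p \<in> slots k n" "{u, v} = {Vv (fst p), \<phi> p}"
      unfolding edges by blast
    then show ?thesis
    proof cases
      case 1
      then show ?thesis using induced_sum_U induced_sum_V assms uv by (auto simp: doubleton_eq_iff)
    next
      case 2
      then have "induced_sum E f (Uv (fst p)) \<noteq> induced_sum E f (\<phi> p)"
        using induced_sum_U[of "fst p"] induced_sum_X[of "\<phi> p"] assms by (auto simp: mem_slots_iff)
      then show ?thesis using 2 by (auto simp: doubleton_eq_iff)
    next
      case 3
      then have "induced_sum E f (Vv (fst p)) \<noteq> induced_sum E f (\<phi> p)"
        using induced_sum_V[of "fst p"] induced_sum_X[of "\<phi> p"] assms by (auto simp: mem_slots_iff)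
      then show ?thesis using 3 by (auto simp: doubleton_eq_iff)
    qed
  qed
  then show ?thesis using bij_labels by (simp add: local_antimagic_def)
qed

lemma three_le_colours:
  assumes "n \<ge> 1" "local_antimagic (W, E) g"
  shows "3 \<le> card (induced_sum E g ` W)"
proof -
  have p: "(1, 1) \<in> slots k n" using assms(1) by (simp add: mem_slots_iff)
  define T where "T = {Uv 1, Vv 1, \<phi> (1, 1)}"
  have T: "T \<subseteq> W" using p by (auto simp: T_def verts)
  have e: "{Uv 1, Vv 1} \<in> E" "{Uv 1, \<phi> (1, 1)} \<in> E" "{Vv 1, \<phi> (1, 1)} \<in> E"
    using p unfolding edges by (force intro!: image_eqI)+
  have ne: "induced_sum E g u \<noteq> induced_sum E g v" if "{u, v} \<in> E" for u v
    using assms(2) that by (simp add: local_antimagic_def)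
  have "card (induced_sum E g ` T) = 3"
    using e[THEN ne] by (simp add: T_def)
  moreover have "card (induced_sum E g ` T) \<le> card (induced_sum E g ` W)"
    using T by (intro card_mono image_mono) (simp_all add: verts)
  ultimately show ?thesis by simp
qed

lemma chi_la_eq_3:
  assumes "n \<ge> 1" "c \<noteq> u_sum k n" "c \<noteq> v_sum k n"
  shows "chi_la (W, E) = 3"
proof (rule antisym)
  have "induced_sum E f ` W \<subseteq> {u_sum k n, v_sum k n, c}"
    using induced_sum_U induced_sum_V induced_sum_X assms(1) by (auto simp: verts)
  then have "card (induced_sum E f ` W) \<le> card {u_sum k n, v_sum k n, c}"
    by (intro card_mono) auto
  also have "\<dots> \<le> 3" by (simp add: card_insert_if)
  finally have "enat (card (induced_sum E f ` W)) \<le> 3" by (simp add: numeral_eq_enat)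
  then show "chi_la (W, E) \<le> 3"
    unfolding chi_la_def using local_antimagic_label[OF assms]
    by (intro INF_lower2[of f]) auto
  show "3 \<le> chi_la (W, E)"
    unfolding chi_la_def using three_le_colours[OF assms(1)]
    by (intro INF_greatest) (simp add: numeral_eq_enat)
qed

section \<open>Delete-add operations preserve the invariant\<close>

text \<open>Let slots \<open>a\<close> and \<open>b\<close> carry the two chosen pairs of edges.
  Afterwards \<open>a\<close> keeps its row and labels but ends in \<open>x'\<close>, and
  \<open>b\<close> ends in \<open>x\<close>; this is \<open>\<phi>\<close> after the transposition
  of \<open>a\<close> and \<open>b\<close>.\<close>

lemma delete_add_swaps:
  assumes "delete_add k n s ((W, E), f) ((W', E'), f')"
  shows "\<exists>\<psi>. slot_graph k n c \<psi> W' E' f'"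
  using assms
proof cases
  case (1 x B j x' B' j' i i')
  let ?I = "slots k n"
  have x: "x = Xv B j" "x' = Xv B' j'" and xx: "x \<noteq> x'" by fact+
  have E': "E' = (E - {{x, Uv i}, {x, Vv i}, {x', Uv i'}, {x', Vv i'}})
      \<union> {{x, Uv i'}, {x, Vv i'}, {x', Uv i}, {x', Vv i}}"
    and f': "f' = f({x, Uv i'} := f {x', Uv i'}, {x, Vv i'} := f {x', Vv i'},
            {x', Uv i} := f {x, Uv i}, {x', Vv i} := f {x, Vv i})"
    by fact+
  have sums: "f {Uv i, x} + f {Vv i, x} = pair_sum k n" "f {Uv i', x'} + f {Vv i', x'} = pair_sum k n"
    using 1 by (simp_all only: insert_commute)
  have ux: "{x, Uv l} \<in> E \<longleftrightarrow> (\<exists>p\<in>?I. fst p = l \<and> \<phi> p = x)"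
    "{x', Uv l} \<in> E \<longleftrightarrow> (\<exists>p\<in>?I. fst p = l \<and> \<phi> p = x')" for l
    unfolding x using ux_edge_iff[of l] by (simp_all add: insert_commute)
  obtain a where a: "a \<in> ?I" "fst a = i" "\<phi> a = x"
    using ux(1) \<open>{x, Uv i} \<in> E\<close> by blast
  obtain b where b: "b \<in> ?I" "fst b = i'" "\<phi> b = x'"
    using ux(2) \<open>{x', Uv i'} \<in> E\<close> by blast
  have nocommon: "\<not> ({x, y} \<in> E \<and> {x', y} \<in> E)" for y using 1 by blast
  \<comment> \<open>A row with slots at both \<open>x\<close> and \<open>x'\<close> would make its u
    vertex a common neighbor.\<close>
  have sep: "fst p \<noteq> fst q" if "p \<in> ?I" "q \<in> ?I" "\<phi> p = x" "\<phi> q = x'" for p q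
    using nocommon[of "Uv (fst p)"] ux that by metis
  define \<tau> where "\<tau> = Transposition.transpose a b"
  have \<tau>: "\<tau> a = b" "\<tau> b = a" "\<And>p. p \<noteq> a \<Longrightarrow> p \<noteq> b \<Longrightarrow> \<tau> p = p" "\<And>p. \<tau> (\<tau> p) = p"
    by (auto simp: \<tau>_def)
  have \<tau>I: "\<tau> p \<in> ?I \<longleftrightarrow> p \<in> ?I" for p
    using a(1) b(1) \<tau> by metis
  define \<psi> where "\<psi> p = \<phi> (\<tau> p)" for p
  have \<psi>: "\<psi> a = x'" "\<psi> b = x" "\<And>p. p \<noteq> a \<Longrightarrow> p \<noteq> b \<Longrightarrow> \<psi> p = \<phi> p"
    using a b \<tau> by (auto simp: \<psi>_def)
  define I0 where "I0 = ?I - {a, b}"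
  have I: "?I = insert a (insert b I0)" using a b by (auto simp: I0_def)
  have I0: "p \<in> ?I" "p \<noteq> a" "p \<noteq> b" if "p \<in> I0" for p using that by (auto simp: I0_def)
  have xneq: "x \<noteq> Uv l" "x \<noteq> Vv l" "x' \<noteq> Uv l" "x' \<noteq> Vv l" for l using x by auto
  let ?\<sigma> = "\<lambda>p. label_ux k n (fst p) (snd p) + label_vx k (fst p) (snd p)"
  \<comment> \<open>Both are \<open>pair_sum k n\<close> by the condition on the operation; this is
    what preserves the fibre sums.\<close>
  have "?\<sigma> a = ?\<sigma> b"
    using f_ux[OF a(1)] f_vx[OF a(1)] f_ux[OF b(1)] f_vx[OF b(1)] sums a b
    by simp
  then have \<sigma>: "?\<sigma> (\<tau> p) = ?\<sigma> p" for p
    using \<tau> by (cases "p = a"; cases "p = b") auto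
  \<comment> \<open>No other slot carries a deleted edge, by \<open>no_parallel\<close>, and none
    carries an added edge, by \<open>sep\<close>.\<close>
  have fresh: "\<not> (fst p = i \<and> \<phi> p = x)" "\<not> (fst p = i' \<and> \<phi> p = x')"
      "\<not> (fst p = i \<and> \<phi> p = x')" "\<not> (fst p = i' \<and> \<phi> p = x)" if "p \<in> I0" for p
    using no_parallel[of p a] no_parallel[of p b] sep[of a p] sep[of p b] I0[OF that] a b by auto
  have "slot_graph k n c \<psi> W E' f'"
  proof
    fix p assume "p \<in> ?I"
    then show "\<exists>B j. \<psi> p = Xv B j" unfolding \<psi>_def using is_X \<tau>I by blast
  next
    fix p q assume pq: "p \<in> ?I" "q \<in> ?I" "\<psi> p = \<psi> q" "fst p = fst q"
    \<comment> \<open>Under \<open>\<psi>\<close>, \<open>a\<close> is the only slot joining row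
      \<open>i\<close> to \<open>x'\<close>, and \<open>b\<close> the only one joining row
      \<open>i'\<close> to \<open>x\<close>.\<close>
    have A: "q = a" if "q \<in> ?I" "\<psi> q = x'" "fst q = i" for q
      using that fresh(3)[of q] \<psi>(1,2) \<psi>(3)[of q] I0[of q] xx unfolding I by auto
    have B: "q = b" if "q \<in> ?I" "\<psi> q = x" "fst q = i'" for q
      using that fresh(4)[of q] \<psi>(1,2) \<psi>(3)[of q] I0[of q] xx unfolding I by auto
    show "p = q"
    proof (cases "p \<in> {a, b} \<or> q \<in> {a, b}")
      case False
      then show ?thesis using pq \<psi>(3) no_parallel by auto
    next
      case True
      then show ?thesis using A[OF pq(1)] A[OF pq(2)] B[OF pq(1)] B[OF pq(2)] pq(3,4) \<psi>(1,2) a(2) b(2)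
        by auto
    qed
  next
    have "\<psi> ` ?I = \<phi> ` ?I" unfolding I using \<psi> a b I0 by (auto simp: image_iff)
    then show "W = Uv ` {1..2*k+1} \<union> Vv ` {1..2*k+1} \<union> \<psi> ` ?I" using verts by simp
  next
    define C U V where "C = (\<lambda>i. {Uv i, Vv i}) ` {1..2*k+1}"
      and "U = (\<lambda>p. {Uv (fst p), \<phi> p}) ` I0" and "V = (\<lambda>p. {Vv (fst p), \<phi> p}) ` I0"
    have "(\<lambda>p. {Uv (fst p), \<psi> p}) ` I0 = U" "(\<lambda>p. {Vv (fst p), \<psi> p}) ` I0 = V"
      unfolding U_def V_def using \<psi>(3) I0(2,3) by (auto intro!: image_cong)
    then have new: "(\<lambda>p. {Uv (fst p), \<psi> p}) ` ?I = {{x', Uv i}, {x, Uv i'}} \<union> U"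
      "(\<lambda>p. {Vv (fst p), \<psi> p}) ` ?I = {{x', Vv i}, {x, Vv i'}} \<union> V"
      unfolding I image_insert a b \<psi>(1,2) by (simp_all add: insert_commute)
    have old: "(\<lambda>p. {Uv (fst p), \<phi> p}) ` ?I = {{x, Uv i}, {x', Uv i'}} \<union> U"
      "(\<lambda>p. {Vv (fst p), \<phi> p}) ` ?I = {{x, Vv i}, {x', Vv i'}} \<union> V"
      unfolding I image_insert a b U_def V_def by (simp_all add: insert_commute)
    \<comment> \<open>\<open>E'\<close> arises by set difference, so the deleted edges must not also
      come from a slot that stays.\<close>
    define R where "R = {{x, Uv i}, {x, Vv i}, {x', Uv i'}, {x', Vv i'}}"
    have "R \<inter> (C \<union> U \<union> V) = {}"
      unfolding C_def U_def V_def R_def using xneq by (auto simp: doubleton_eq_iff dest: fresh)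
    moreover have "E = R \<union> (C \<union> U \<union> V)"
      unfolding edges old C_def[symmetric] R_def by (simp add: Un_ac insert_commute)
    ultimately have "E - R = C \<union> U \<union> V" by blast
    then show "E' = (\<lambda>i. {Uv i, Vv i}) ` {1..2*k+1}
        \<union> (\<lambda>p. {Uv (fst p), \<psi> p}) ` ?I \<union> (\<lambda>p. {Vv (fst p), \<psi> p}) ` ?I"
      unfolding E' new C_def[symmetric] R_def[symmetric] by (simp add: Un_ac insert_commute)
  next
    fix l assume "l \<in> {1..2*k+1}"
    then show "f' {Uv l, Vv l} = int l" using xneq f_uv by (auto simp: f' doubleton_eq_iff)
  next
    fix p assume p: "p \<in> ?I"
    then consider "p = a" | "p = b" | "p \<in> I0" unfolding I by auto
    then show "f' {Uv (fst p), \<psi> p} = label_ux k n (fst p) (snd p)"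
    proof cases
      case 1
      have "f' {Uv i, x'} = f {Uv i, x}"
        using xneq xx by (simp add: f' doubleton_eq_iff insert_commute)
      then show ?thesis using f_ux[OF a(1)] a \<psi> 1 by simp
    next
      case 2
      have "f' {Uv i', x} = f {Uv i', x'}"
        using xneq xx by (simp add: f' doubleton_eq_iff insert_commute)
      then show ?thesis using f_ux[OF b(1)] b \<psi> 2 by simp
    next
      case 3
      have "f' {Uv (fst p), \<phi> p} = f {Uv (fst p), \<phi> p}"
        using xneq fresh[OF 3] by (auto simp: f' doubleton_eq_iff)
      then show ?thesis using f_ux[OF p] \<psi>(3) I0[OF 3] by simp
    qed
  next
    fix p assume p: "p \<in> ?I"
    then consider "p = a" | "p = b" | "p \<in> I0" unfolding I by auto
    then show "f' {Vv (fst p), \<psi> p} = label_vx k (fst p) (snd p)"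
    proof cases
      case 1
      have "f' {Vv i, x'} = f {Vv i, x}"
        using xneq xx by (simp add: f' doubleton_eq_iff insert_commute)
      then show ?thesis using f_vx[OF a(1)] a \<psi> 1 by simp
    next
      case 2
      have "f' {Vv i', x} = f {Vv i', x'}"
        using xneq xx by (simp add: f' doubleton_eq_iff insert_commute)
      then show ?thesis using f_vx[OF b(1)] b \<psi> 2 by simp
    next
      case 3
      have "f' {Vv (fst p), \<phi> p} = f {Vv (fst p), \<phi> p}"
        using xneq fresh[OF 3] by (auto simp: f' doubleton_eq_iff)
      then show ?thesis using f_vx[OF p] \<psi>(3) I0[OF 3] by simp
    qed
  next
    fix y assume "y \<in> \<psi> ` ?I"
    then have y: "y \<in> \<phi> ` ?I" using \<tau>I by (auto simp: \<psi>_def)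
    \<comment> \<open>The involution \<open>\<tau>\<close> carries the fibres of
      \<open>\<psi>\<close> to those of \<open>\<phi>\<close> and respects label sums.\<close>
    have "(\<Sum>p | p \<in> ?I \<and> \<psi> p = y. ?\<sigma> p) = (\<Sum>p | p \<in> ?I \<and> \<phi> p = y. ?\<sigma> p)"
      using \<tau>I \<tau>(4) \<sigma>
      by (intro sum.reindex_bij_witness[of _ \<tau> \<tau>]) (auto simp: \<psi>_def)
    then show "(\<Sum>p | p \<in> ?I \<and> \<psi> p = y. ?\<sigma> p) = c" using fibre_sum[OF y] by simp
  qed
  moreover have "W' = W" by fact
  ultimately show ?thesis by blast
qed

end

section \<open>The graphs of \<open>G_family\<close> satisfy the invariant\<close>

text \<open>Merging keeps the column index, so two slots of one row stay apart and the fibre of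
  \<open>Xv B j\<close> is \<open>B\<close> in column \<open>j\<close>. Its label sum is the one
  prescribed by \<open>admissible\<close>.\<close>

lemma G_family_slot_graph:
  assumes "((W, E), f) \<in> G_family k n r s"
  shows "\<exists>\<phi>. slot_graph k n ((2 * int s + 1) * pair_sum k n) \<phi> W E f"
proof -
  let ?I = "slots k n"
  obtain P where adm: "\<And>j. j \<in> {1..2*n} \<Longrightarrow> admissible k n r s j (P j)"
    and G: "((W, E), f) = identify (merge P) (Gamma k n)"
    using assms unfolding G_family_def by blast
  have part: "partition_on {1..2*k+1} (P j)" if "j \<in> {1..2*n}" for j
    using adm[OF that] by (simp add: admissible_def)
  define \<phi> where "\<phi> p = merge P (Xv {fst p} (snd p))" for p
  have W: "W = merge P ` Gamma_verts k n" and E: "E = (`) (merge P) ` Gamma_edges k n"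
    and f: "f = Gamma_label k n \<circ> the_inv_into (Gamma_edges k n) ((`) (merge P))"
    using G by (auto simp: identify_def Gamma_def)
  \<comment> \<open>Injectivity of merging on edges lets the inverse in \<open>identify\<close>
    recover the original edge.\<close>
  have f_im: "f (merge P ` e) = Gamma_label k n e" if "e \<in> Gamma_edges k n" for e
    using that by (simp add: f the_inv_into_f_f[OF inj_on_merge])
  have "slot_graph k n ((2 * int s + 1) * pair_sum k n) \<phi> W E f"
  proof
    fix p show "\<exists>B j. \<phi> p = Xv B j" by (simp add: \<phi>_def)
  next
    fix p q assume "\<phi> p = \<phi> q" "fst p = fst q"
    then show "p = q" by (simp add: \<phi>_def prod_eq_iff)
  next
    show "W = Uv ` {1..2*k+1} \<union> Vv ` {1..2*k+1} \<union> \<phi> ` ?I"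
      unfolding W Gamma_verts_def setcompr_slots image_Un image_image \<phi>_def by simp
  next
    have edges': "Gamma_edges k n = (\<lambda>i. {Uv i, Vv i}) ` {1..2*k+1}
        \<union> (\<lambda>p. {Uv (fst p), Xv {fst p} (snd p)}) ` ?I
        \<union> (\<lambda>p. {Vv (fst p), Xv {fst p} (snd p)}) ` ?I"
      unfolding Gamma_edges_def setcompr_slots by (simp only: Setcompr_eq_image)
    show "E = (\<lambda>i. {Uv i, Vv i}) ` {1..2*k+1}
        \<union> (\<lambda>p. {Uv (fst p), \<phi> p}) ` ?I \<union> (\<lambda>p. {Vv (fst p), \<phi> p}) ` ?I"
      unfolding E edges' image_Un image_image \<phi>_def by simp
  next
    fix i assume "i \<in> {1..2*k+1}"
    then have "{Uv i, Vv i} \<in> Gamma_edges k n" by (auto simp: Gamma_edges_def)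
    from f_im[OF this] show "f {Uv i, Vv i} = int i" by (simp add: Gamma_label_simps)
  next
    fix p assume "p \<in> ?I"
    then have "{Uv (fst p), Xv {fst p} (snd p)} \<in> Gamma_edges k n"
      unfolding Gamma_edges_def setcompr_slots by blast
    from f_im[OF this] show "f {Uv (fst p), \<phi> p} = label_ux k n (fst p) (snd p)"
      by (simp add: Gamma_label_simps \<phi>_def)
  next
    fix p assume "p \<in> ?I"
    then have "{Vv (fst p), Xv {fst p} (snd p)} \<in> Gamma_edges k n"
      unfolding Gamma_edges_def setcompr_slots by blast
    from f_im[OF this] show "f {Vv (fst p), \<phi> p} = label_vx k (fst p) (snd p)"
      by (simp add: Gamma_label_simps \<phi>_def)
  next
    fix x assume "x \<in> \<phi> ` ?I"
    then obtain i j where ij: "i \<in> {1..2*k+1}" "j \<in> {1..2*n}" and x: "x = \<phi> (i, j)"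
      by (auto simp: mem_slots_iff)
    obtain B where B: "B \<in> P j" "i \<in> B"
      using partition_onD1[OF part[OF ij(2)]] ij(1) by blast
    have Bsub: "B \<subseteq> {1..2*k+1}" using part[OF ij(2)] B by (auto simp: partition_on_def)
    have xB: "x = Xv B j"
      using merge_block[where P = P and j = j, OF part[OF ij(2)] B] by (simp add: x \<phi>_def del: merge.simps)
    have "{p. p \<in> ?I \<and> \<phi> p = x} = (\<lambda>l. (l, j)) ` B"
    proof (intro equalityI subsetI)
      fix p assume "p \<in> {p. p \<in> ?I \<and> \<phi> p = x}"
      then have p: "p \<in> ?I" "\<phi> p = Xv B j" using xB by auto
      then have j: "snd p = j" by (simp add: \<phi>_def)
      obtain C where C: "C \<in> P j" "fst p \<in> C"
        using partition_onD1[OF part[OF ij(2)]] p(1) mem_slots_iff by blast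
      have "\<phi> p = Xv C j"
        using merge_block[where P = P and j = j, OF part[OF ij(2)] C] j by (simp add: \<phi>_def del: merge.simps)
      then show "p \<in> (\<lambda>l. (l, j)) ` B" using p(2) C j by (force simp: image_iff)
    next
      fix p assume "p \<in> (\<lambda>l. (l, j)) ` B"
      then obtain l where l: "l \<in> B" "p = (l, j)" by auto
      then show "p \<in> {p. p \<in> ?I \<and> \<phi> p = x}"
        using merge_block[where P = P and j = j, OF part[OF ij(2)] B(1) l(1)] Bsub ij(2) xB
        by (auto simp: \<phi>_def mem_slots_iff simp del: merge.simps)
    qed
    moreover have "inj_on (\<lambda>l. (l, j)) B" by (simp add: inj_on_def)
    moreover have "(\<Sum>l\<in>B. label_ux k n l j + label_vx k l j) = (2 * int s + 1) * pair_sum k n"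
      using adm[OF ij(2)] B(1) by (simp add: admissible_def sigma_def Gamma_label_simps)
    ultimately show "(\<Sum>p | p \<in> ?I \<and> \<phi> p = x. label_ux k n (fst p) (snd p) + label_vx k (fst p) (snd p))
        = (2 * int s + 1) * pair_sum k n"
      by (simp add: sum.reindex)
  qed
  then show ?thesis by blast
qed

section \<open>Graphs reached by chains of operations, and their chromatic number\<close>

lemma H_family_slot_graph:
  assumes "(W, E) \<in> H_family k n r s"
  shows "\<exists>\<phi> f. slot_graph k n ((2 * int s + 1) * pair_sum k n) \<phi> W E f"
proof -
  \<comment> \<open>Graph and labeling are packed into one argument, the form related by
    \<open>delete_add\<close>, for the induction along the chain.\<close>
  let ?S = "\<lambda>L. \<exists>\<phi>. slot_graph k n ((2 * int s + 1) * pair_sum k n) \<phi>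
              (fst (fst L)) (snd (fst L)) (snd L)"
  obtain G f where G: "G \<in> G_family k n r s" and steps: "(delete_add k n s)\<^sup>+\<^sup>+ G ((W, E), f)"
    using assms by (auto simp: H_family_def)
  have step: "?S L'" if "?S L" "delete_add k n s L L'" for L L'
    using that by (metis prod.collapse slot_graph.delete_add_swaps)
  have base: "?S G" using G_family_slot_graph G by (metis prod.collapse)
  from steps base have "?S ((W, E), f)"
    by (induction rule: tranclp_induct) (blast intro: step)+
  then show ?thesis by auto
qed

theorem theorem2p6:
  fixes n r s k :: nat and H :: "vertex graph"
  assumes "n \<ge> 2" and "r \<ge> 1" and "s \<ge> 1"
    and "k = 2 * r * s + r + s"
    and "H \<in> H_family k n r s"
  shows "chi_la H = 3"
proof -
  obtain W E where H: "H = (W, E)" by (cases H)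
  obtain \<phi> f where "slot_graph k n ((2 * int s + 1) * pair_sum k n) \<phi> W E f"
    using H_family_slot_graph assms(5) H by blast
  then show ?thesis
    unfolding H using slot_graph.chi_la_eq_3 x_sum_neq[OF assms(1,4)] assms(1) by auto
qed

end
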